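(* Let $\Gamma$, $V$, $T$, $\Upsilon$, $\Psi$, $q$, $e$ be as in the context, and let $\pi_1,\pi_2:U_q(\mathfrak{sl}_2)\to\mathrm{End}(V)$ be the representations given by the first and second module structures described in the context. Then $$\pi_2(k)=\pi_1(k),\qquad \pi_2(e)=-q^{-2e}\Upsilon^2\Psi^{-2}\pi_1(e),\qquad \pi_2(f)=-q^{2e}\Upsilon^{-2}\Psi^{2}\pi_1(f).$$
   Context: Let $b$ be a prime power, $D\ge3$, and $U$ a finite-dimensional $\mathbb{F}_b$-space with one of the nondegenerate forms: symplectic, $\dim U=2D$ ($e=1$); quadratic, $\dim U=2D+1$ ($e=1$); quadratic of Witt index $D$, $\dim U=2D$ ($e=0$); quadratic of Witt index $D$, $\dim U=2D+2$ ($e=2$); Hermitean, $\dim U=2D+1$, $b$ a square ($e=3/2$); Hermitean, $\dim U=2D$, $b$ a square ($e=1/2$). (The number $e$ should not be confused with the generator $e$ of $U_q(\mathfrak{sl}_2)$; it appears only in exponents $q^{\pm2e}$.) The dual polar graph $\Gamma$: vertices $X$ = maximal isotropic subspaces, $y\sim z$ iff $\dim(y\cap z)=D-1$, $\partial(y,z)=D-\dim(y\cap z)$. Let $q=\sqrt b>0$. $V=\mathbb{C}^X$, $A$ adjacency matrix, $\theta_0>\dots>\theta_D$ eigenvalues, $E_i$ orthogonal projection onto the $\theta_i$-eigenspace; fix $x\in X$, $E^*_i$ diagonal with $(y,y)$-entry $1$ if $\partial(x,y)=i$ else $0$, $A^*$ diagonal with $(y,y)$-entry $|X|(E_1)_{xy}$,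 $T$ generated by $A,A^*$. For irreducible $T$-module $W$: $r=\min\{i:E^*_iW\ne0\}$, $t=\min\{i:E_iW\ne0\}$, $d=|\{i:E^*_iW\ne0\}|-1$. $\Upsilon$ (resp. $\Psi$) is the central element of $T$ acting on the span of the irreducible $T$-modules with $r+t+d-D=\mu$ (resp. $r-t=\nu$) as $q^\mu I$ (resp. $q^\nu I$). $U_q(\mathfrak{sl}_2)$ has generators $x,y,z^{\pm1}$ with relations $zz^{-1}=z^{-1}z=1$, $\frac{qxy-q^{-1}yx}{q-q^{-1}}=\frac{qyz-q^{-1}zy}{q-q^{-1}}=\frac{qzx-q^{-1}xz}{q-q^{-1}}=1$, and elements $k^{\pm1}=z^{\pm1}$, $f=(q-q^{-1})^{-1}(x-z^{-1})$, $e=q^{-1}(q-q^{-1})^{-1}(1-zy)$ (these satisfy $ke=q^2ek$, $kf=q^{-2}fk$, $ef-fe=\frac{k-k^{-1}}{q-q^{-1}}$ and generate $U_q(\mathfrak{sl}_2)$). Put $h=\frac{1-q^{2e}}{q^2-1}$, $h^*=-\frac{b(b^{D+e-2}+1)}{b-1}$, $\kappa=\frac{q^{2e+D}}{q^2-1}$, $\kappa^*=\xi q^{-D}$ with $\xi=\frac{b^2(b^{D+e-2}+1)(b^{D+e-1}+1)}{(b-1)(b^e+b)}$, $\upsilon=-\frac{q^D}{q^2-1}$. The first module structure is the unique one with $A=h1+\kappa\Upsilon^{-1}\Psi x+\upsilon\Upsilon\Psi^{-1}y$, $A^*=h^*1+\kappa^*\Upsilon^{-1}\Psi^{-1}z$;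 the second is the unique one with $A=h1+\kappa\Upsilon^{-1}\Psi y+\upsilon\Upsilon\Psi^{-1}x$, $A^*=h^*1+\kappa^*\Upsilon^{-1}\Psi^{-1}z$. *)

theory Defs
  imports
    "HOL-Analysis.Analysis"
    "HOL-Algebra.QuotRing"
    "HOL-Library.Poly_Mapping"
begin

section \<open>Forms and dual polar graphs\<close>

text \<open>The finite field is the type \<open>'k\<close>, so \<open>b = CARD('k)\<close>; the space \<open>U\<close> is the type \<open>'u\<close>
  with scalar multiplication \<open>smul\<close>.\<close>

datatype ('k, 'u) polar_form =
    Symplectic "'u \<Rightarrow> 'u \<Rightarrow> 'k"
  | Quadratic "'u \<Rightarrow> 'k"
  | Hermitean "'u \<Rightarrow> 'u \<Rightarrow> 'k"

definition bilinear_form :: "('k::field \<Rightarrow> 'u::ab_group_add \<Rightarrow> 'u) \<Rightarrow> ('u \<Rightarrow> 'u \<Rightarrow> 'k) \<Rightarrow> bool" where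
  "bilinear_form smul B \<longleftrightarrow>
     (\<forall>u. Vector_Spaces.linear smul (*) (B u)) \<and>
     (\<forall>v. Vector_Spaces.linear smul (*) (\<lambda>u. B u v))"

definition nondegenerate_symplectic_form ::
    "('k::field \<Rightarrow> 'u::ab_group_add \<Rightarrow> 'u) \<Rightarrow> ('u \<Rightarrow> 'u \<Rightarrow> 'k) \<Rightarrow> bool" where
  "nondegenerate_symplectic_form smul B \<longleftrightarrow>
     bilinear_form smul B \<and> (\<forall>u. B u u = 0) \<and> (\<forall>u. (\<forall>v. B u v = 0) \<longrightarrow> u = 0)"

definition polarization :: "('u::ab_group_add \<Rightarrow> 'k::field) \<Rightarrow> 'u \<Rightarrow> 'u \<Rightarrow> 'k" where
  "polarization Q u v = Q (u + v) - Q u - Q v"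

text \<open>Nondegeneracy of a quadratic form means that no nonzero singular vector lies in the radical of
  its polarization. In characteristic 2 and odd dimension the radical itself is never zero.\<close>

definition nondegenerate_quadratic_form ::
    "('k::field \<Rightarrow> 'u::ab_group_add \<Rightarrow> 'u) \<Rightarrow> ('u \<Rightarrow> 'k) \<Rightarrow> bool" where
  "nondegenerate_quadratic_form smul Q \<longleftrightarrow>
     (\<forall>c u. Q (smul c u) = c\<^sup>2 * Q u) \<and> bilinear_form smul (polarization Q) \<and>
     (\<forall>u. Q u = 0 \<and> (\<forall>v. polarization Q u v = 0) \<longrightarrow> u = 0)"

text \<open>For a field with \<open>s\<^sup>2\<close> elements, \<open>c \<mapsto> c ^ s\<close> is the involutory field automorphism.\<close>

definition nondegenerate_hermitean_form ::
    "('k::field \<Rightarrow> 'u::ab_group_add \<Rightarrow> 'u) \<Rightarrow> nat \<Rightarrow> ('u \<Rightarrow> 'u \<Rightarrow> 'k) \<Rightarrow> bool" where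
  "nondegenerate_hermitean_form smul s H \<longleftrightarrow>
     (\<forall>v. Vector_Spaces.linear smul (*) (\<lambda>u. H u v)) \<and>
     (\<forall>u v. H v u = (H u v) ^ s) \<and> (\<forall>u. (\<forall>v. H u v = 0) \<longrightarrow> u = 0)"

fun vanishes_on :: "('k::field, 'u) polar_form \<Rightarrow> 'u set \<Rightarrow> bool" where
  "vanishes_on (Symplectic B) W \<longleftrightarrow> (\<forall>u\<in>W. \<forall>v\<in>W. B u v = 0)"
| "vanishes_on (Quadratic Q) W \<longleftrightarrow> (\<forall>u\<in>W. Q u = 0)"
| "vanishes_on (Hermitean H) W \<longleftrightarrow> (\<forall>u\<in>W. \<forall>v\<in>W. H u v = 0)"

definition isotropic_subspaces ::
    "('k::field \<Rightarrow> 'u::ab_group_add \<Rightarrow> 'u) \<Rightarrow> ('k, 'u) polar_form \<Rightarrow> 'u set set" where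
  "isotropic_subspaces smul F = {W. module.subspace smul W \<and> vanishes_on F W}"

definition maximal_isotropic_subspaces ::
    "('k::field \<Rightarrow> 'u::ab_group_add \<Rightarrow> 'u) \<Rightarrow> ('k, 'u) polar_form \<Rightarrow> 'u set set" where
  "maximal_isotropic_subspaces smul F =
     {W \<in> isotropic_subspaces smul F. \<forall>W' \<in> isotropic_subspaces smul F. W \<subseteq> W' \<longrightarrow> W' = W}"

definition witt_index ::
    "('k::field \<Rightarrow> 'u::ab_group_add \<Rightarrow> 'u) \<Rightarrow> ('k, 'u) polar_form \<Rightarrow> nat" where
  "witt_index smul F = Max (vector_space.dim smul ` isotropic_subspaces smul F)"

text \<open>The six families, with the parameter \<open>e\<close>. Since \<open>dim\<close> is 0 on infinite-dimensional spaces, the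
  dimension conditions (for \<open>D > 0\<close>) include finite-dimensionality.\<close>

definition dual_polar_type ::
    "('k::{field,finite} \<Rightarrow> 'u::ab_group_add \<Rightarrow> 'u) \<Rightarrow> ('k, 'u) polar_form \<Rightarrow> nat \<Rightarrow> real \<Rightarrow> bool" where
  "dual_polar_type smul F D e \<longleftrightarrow>
     (let n = vector_space.dim smul (UNIV :: 'u set) in
      case F of
        Symplectic B \<Rightarrow> nondegenerate_symplectic_form smul B \<and> n = 2 * D \<and> e = 1
      | Quadratic Q \<Rightarrow> nondegenerate_quadratic_form smul Q \<and>
          (n = 2 * D + 1 \<and> e = 1 \<or>
           n = 2 * D \<and> witt_index smul F = D \<and> e = 0 \<or>
           n = 2 * D + 2 \<and> witt_index smul F = D \<and> e = 2)
      | Hermitean H \<Rightarrow>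
          (\<exists>s. s\<^sup>2 = CARD('k) \<and> nondegenerate_hermitean_form smul s H) \<and>
          (n = 2 * D + 1 \<and> e = 3/2 \<or> n = 2 * D \<and> e = 1/2))"

text \<open>In what follows \<open>vert\<close> is a bijection from a finite index type \<open>'x\<close> onto the vertex set \<open>X\<close> of the
  dual polar graph; this identifies \<open>\<complex>\<^sup>X\<close> with \<open>complex ^ 'x\<close> and the endomorphisms of \<open>\<complex>\<^sup>X\<close> with
  matrices. The scalar multiple \<open>c M\<close> of a matrix is written \<open>mat c ** M\<close>.\<close>

definition adjacency_matrix ::
    "('k::field \<Rightarrow> 'u::ab_group_add \<Rightarrow> 'u) \<Rightarrow> nat \<Rightarrow> ('x::finite \<Rightarrow> 'u set) \<Rightarrow> complex^'x^'x" where
  "adjacency_matrix smul D vert =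
     (\<chi> y z. if vector_space.dim smul (vert y \<inter> vert z) = D - 1 then 1 else 0)"

definition graph_dist ::
    "('k::field \<Rightarrow> 'u::ab_group_add \<Rightarrow> 'u) \<Rightarrow> nat \<Rightarrow> ('x::finite \<Rightarrow> 'u set) \<Rightarrow> 'x \<Rightarrow> 'x \<Rightarrow> nat" where
  "graph_dist smul D vert y z = D - vector_space.dim smul (vert y \<inter> vert z)"

definition eigenspace :: "complex^'x^'x \<Rightarrow> complex \<Rightarrow> (complex^'x) set" where
  "eigenspace M c = {v. M *v v = c *s v}"

text \<open>The \<open>i\<close>-th largest real eigenvalue, counting from 0 and without multiplicity (the adjacency
  matrix is real symmetric, so all its eigenvalues are real).\<close>

definition nth_eigenvalue :: "complex^'x^'x \<Rightarrow> nat \<Rightarrow> real" where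
  "nth_eigenvalue M i =
     rev (sorted_list_of_set {c :: real. eigenspace M (complex_of_real c) \<noteq> {0}}) ! i"

definition conj_transpose :: "complex^'x^'x \<Rightarrow> complex^'x^'x" where
  "conj_transpose M = (\<chi> y z. cnj (M $ z $ y))"

definition orthogonal_projection :: "(complex^'x::finite) set \<Rightarrow> complex^'x^'x" where
  "orthogonal_projection S =
     (THE P. P ** P = P \<and> conj_transpose P = P \<and> range ((*v) P) = S)"

definition eigenprojection :: "complex^'x::finite^'x \<Rightarrow> nat \<Rightarrow> complex^'x^'x" where
  "eigenprojection A i = orthogonal_projection (eigenspace A (of_real (nth_eigenvalue A i)))"

definition dual_idempotent ::
    "('k::field \<Rightarrow> 'u::ab_group_add \<Rightarrow> 'u) \<Rightarrow> nat \<Rightarrow> ('x::finite \<Rightarrow> 'u set) \<Rightarrow> 'x \<Rightarrow> nat \<Rightarrow> complex^'x^'x" where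
  "dual_idempotent smul D vert x i =
     (\<chi> y z. if y = z \<and> graph_dist smul D vert x y = i then 1 else 0)"

definition dual_adjacency_matrix :: "complex^'x::finite^'x \<Rightarrow> 'x \<Rightarrow> complex^'x^'x" where
  "dual_adjacency_matrix A x =
     (\<chi> y z. if y = z then of_nat CARD('x) * eigenprojection A 1 $ x $ y else 0)"

section \<open>The subconstituent algebra and its modules\<close>

inductive_set generated_algebra :: "(complex^'x::finite^'x) set \<Rightarrow> (complex^'x^'x) set"
  for G :: "(complex^'x::finite^'x) set" where
  "M \<in> G \<Longrightarrow> M \<in> generated_algebra G"
| "mat c \<in> generated_algebra G"
| "M \<in> generated_algebra G \<Longrightarrow> N \<in> generated_algebra G \<Longrightarrow> M + N \<in> generated_algebra G"
| "M \<in> generated_algebra G \<Longrightarrow> N \<in> generated_algebra G \<Longrightarrow> M ** N \<in> generated_algebra G"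

definition center_of :: "(complex^'x::finite^'x) set \<Rightarrow> (complex^'x^'x) set" where
  "center_of T = {M \<in> T. \<forall>N\<in>T. M ** N = N ** M}"

definition submodule_of :: "(complex^'x::finite^'x) set \<Rightarrow> (complex^'x) set \<Rightarrow> bool" where
  "submodule_of T W \<longleftrightarrow> vec.subspace W \<and> (\<forall>M\<in>T. \<forall>w\<in>W. M *v w \<in> W)"

definition irreducible_submodule_of :: "(complex^'x::finite^'x) set \<Rightarrow> (complex^'x) set \<Rightarrow> bool" where
  "irreducible_submodule_of T W \<longleftrightarrow>
     submodule_of T W \<and> W \<noteq> {0} \<and> (\<forall>W'. submodule_of T W' \<and> W' \<subseteq> W \<longrightarrow> W' = {0} \<or> W' = W)"

text \<open>Below, \<open>E\<close> is a family of idempotents indexed by \<open>0, \<dots>, D\<close>.\<close>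

definition support_indices ::
    "nat \<Rightarrow> (nat \<Rightarrow> complex^'x::finite^'x) \<Rightarrow> (complex^'x) set \<Rightarrow> nat set" where
  "support_indices D E W = {i. i \<le> D \<and> (*v) (E i) ` W \<noteq> {0}}"

definition endpoint ::
    "nat \<Rightarrow> (nat \<Rightarrow> complex^'x::finite^'x) \<Rightarrow> (complex^'x) set \<Rightarrow> nat" where
  "endpoint D E W = Min (support_indices D E W)"

definition module_diam ::
    "nat \<Rightarrow> (nat \<Rightarrow> complex^'x::finite^'x) \<Rightarrow> (complex^'x) set \<Rightarrow> nat" where
  "module_diam D E W = card (support_indices D E W) - 1"

text \<open>\<open>acts_by_power T q \<phi> C\<close>: the element \<open>C\<close> of the center of \<open>T\<close> acts as \<open>q\<^sup>\<mu>\<close> on the span of the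
  irreducible \<open>T\<close>-modules \<open>W\<close> with \<open>\<phi> W = \<mu>\<close>. There is exactly one such \<open>C\<close> when \<open>\<phi>\<close> is invariant under
  isomorphism and \<open>\<complex>\<^sup>X\<close> is completely reducible.\<close>

definition acts_by_power ::
    "(complex^'x::finite^'x) set \<Rightarrow> real \<Rightarrow> ((complex^'x) set \<Rightarrow> int) \<Rightarrow> complex^'x^'x \<Rightarrow> bool" where
  "acts_by_power T q \<phi> C \<longleftrightarrow> C \<in> center_of T \<and>
     (\<forall>\<mu>. \<forall>v \<in> vec.span (\<Union>{W. irreducible_submodule_of T W \<and> \<phi> W = \<mu>}).
        C *v v = of_real (q powi \<mu>) *s v)"

text \<open>The arguments \<open>E\<close> and \<open>Es\<close> are the families \<open>E\<^sub>i\<close> and \<open>E\<^sup>*\<^sub>i\<close>.\<close>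

definition is_Upsilon ::
    "(complex^'x::finite^'x) set \<Rightarrow> real \<Rightarrow> nat \<Rightarrow> (nat \<Rightarrow> complex^'x^'x) \<Rightarrow> (nat \<Rightarrow> complex^'x^'x) \<Rightarrow>
     complex^'x^'x \<Rightarrow> bool" where
  "is_Upsilon T q D E Es =
     acts_by_power T q (\<lambda>W. int (endpoint D Es W) + int (endpoint D E W) + int (module_diam D Es W) - int D)"

definition is_Psi ::
    "(complex^'x::finite^'x) set \<Rightarrow> real \<Rightarrow> nat \<Rightarrow> (nat \<Rightarrow> complex^'x^'x) \<Rightarrow> (nat \<Rightarrow> complex^'x^'x) \<Rightarrow>
     complex^'x^'x \<Rightarrow> bool" where
  "is_Psi T q D E Es = acts_by_power T q (\<lambda>W. int (endpoint D Es W) - int (endpoint D E W))"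

section \<open>The algebra \<open>U\<^sub>q(sl\<^sub>2)\<close> in the equitable presentation\<close>

text \<open>\<open>uq_word\<close> is the free monoid (written additively, as required for the convolution product on
  \<open>poly_mapping\<close>) on the four generators, so \<open>free_uq\<close> is the free associative algebra on them.\<close>

datatype uq_gen = GX | GY | GZ | GZinv

datatype uq_word = Word (letters: "uq_gen list")

instantiation uq_word :: monoid_add
begin

definition zero_uq_word :: uq_word where
  "zero_uq_word = Word []"

definition plus_uq_word :: "uq_word \<Rightarrow> uq_word \<Rightarrow> uq_word" where
  "plus_uq_word v w = Word (letters v @ letters w)"

instance
  by standard (simp_all add: zero_uq_word_def plus_uq_word_def)

end

type_synonym free_uq = "uq_word \<Rightarrow>\<^sub>0 complex"

definition gen :: "uq_gen \<Rightarrow> free_uq" where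
  "gen g = Poly_Mapping.single (Word [g]) 1"

definition scalar :: "complex \<Rightarrow> free_uq" where
  "scalar c = Poly_Mapping.single 0 c"

definition free_uq_ring :: "free_uq ring" where
  "free_uq_ring = \<lparr>carrier = UNIV, monoid.mult = (*), one = 1, ring.zero = 0, add = (+)\<rparr>"

definition q_comm :: "complex \<Rightarrow> free_uq \<Rightarrow> free_uq \<Rightarrow> free_uq" where
  "q_comm q u v = scalar (inverse (q - inverse q)) * (scalar q * u * v - scalar (inverse q) * v * u)"

definition uq_relators :: "complex \<Rightarrow> free_uq set" where
  "uq_relators q =
     {gen GZ * gen GZinv - 1,
      gen GZinv * gen GZ - 1,
      q_comm q (gen GX) (gen GY) - 1,
      q_comm q (gen GY) (gen GZ) - 1,
      q_comm q (gen GZ) (gen GX) - 1}"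

definition uq_ideal :: "complex \<Rightarrow> free_uq set" where
  "uq_ideal q = genideal free_uq_ring (uq_relators q)"

definition Uq :: "complex \<Rightarrow> free_uq set ring" where
  "Uq q = FactRing free_uq_ring (uq_ideal q)"

definition uq_class :: "complex \<Rightarrow> free_uq \<Rightarrow> free_uq set" where
  "uq_class q p = a_r_coset free_uq_ring (uq_ideal q) p"

definition uq_x :: "complex \<Rightarrow> free_uq set" where
  "uq_x q = uq_class q (gen GX)"

definition uq_y :: "complex \<Rightarrow> free_uq set" where
  "uq_y q = uq_class q (gen GY)"

definition uq_z :: "complex \<Rightarrow> free_uq set" where
  "uq_z q = uq_class q (gen GZ)"

definition uq_k :: "complex \<Rightarrow> free_uq set" where
  "uq_k q = uq_z q"

definition uq_f :: "complex \<Rightarrow> free_uq set" where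
  "uq_f q = uq_class q (scalar (inverse (q - inverse q)) * (gen GX - gen GZinv))"

definition uq_e :: "complex \<Rightarrow> free_uq set" where
  "uq_e q = uq_class q (scalar (inverse q * inverse (q - inverse q)) * (1 - gen GZ * gen GY))"

definition matrix_ring :: "(complex^'x::finite^'x) ring" where
  "matrix_ring = \<lparr>carrier = UNIV, monoid.mult = (**), one = mat 1, ring.zero = 0, add = (+)\<rparr>"

definition uq_representation :: "complex \<Rightarrow> (free_uq set \<Rightarrow> complex^'x::finite^'x) \<Rightarrow> bool" where
  "uq_representation q \<pi> \<longleftrightarrow>
     \<pi> \<in> ring_hom (Uq q) matrix_ring \<and>
     (\<forall>c p. \<pi> (uq_class q (scalar c * p)) = mat c ** \<pi> (uq_class q p))"

section \<open>The two module structures\<close>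

definition param_h :: "real \<Rightarrow> real \<Rightarrow> real" where
  "param_h q e = (1 - q powr (2 * e)) / (q\<^sup>2 - 1)"

definition param_h_star :: "real \<Rightarrow> nat \<Rightarrow> real \<Rightarrow> real" where
  "param_h_star b D e = - (b * (b powr (real D + e - 2) + 1) / (b - 1))"

definition param_kappa :: "real \<Rightarrow> nat \<Rightarrow> real \<Rightarrow> real" where
  "param_kappa q D e = q powr (2 * e + real D) / (q\<^sup>2 - 1)"

definition param_xi :: "real \<Rightarrow> nat \<Rightarrow> real \<Rightarrow> real" where
  "param_xi b D e =
     b\<^sup>2 * (b powr (real D + e - 2) + 1) * (b powr (real D + e - 1) + 1) / ((b - 1) * (b powr e + b))"

definition param_kappa_star :: "real \<Rightarrow> real \<Rightarrow> nat \<Rightarrow> real \<Rightarrow> real" where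
  "param_kappa_star b q D e = param_xi b D e * q powr (- real D)"

definition param_upsilon :: "real \<Rightarrow> nat \<Rightarrow> real" where
  "param_upsilon q D = - (q ^ D / (q\<^sup>2 - 1))"

definition cmat :: "real \<Rightarrow> complex^'x::finite^'x" where
  "cmat c = mat (complex_of_real c)"

definition dual_adjacency_equation ::
    "real \<Rightarrow> real \<Rightarrow> nat \<Rightarrow> real \<Rightarrow> complex^'x::finite^'x \<Rightarrow> complex^'x^'x \<Rightarrow> complex^'x^'x \<Rightarrow>
     (free_uq set \<Rightarrow> complex^'x^'x) \<Rightarrow> bool" where
  "dual_adjacency_equation b q D e As \<Upsilon> \<Psi> \<pi> \<longleftrightarrow>
     As = cmat (param_h_star b D e)
        + cmat (param_kappa_star b q D e) ** matrix_inv \<Upsilon> ** matrix_inv \<Psi> ** \<pi> (uq_z (of_real q))"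

definition first_module_structure ::
    "real \<Rightarrow> real \<Rightarrow> nat \<Rightarrow> real \<Rightarrow> complex^'x::finite^'x \<Rightarrow> complex^'x^'x \<Rightarrow> complex^'x^'x \<Rightarrow>
     complex^'x^'x \<Rightarrow> (free_uq set \<Rightarrow> complex^'x^'x) \<Rightarrow> bool" where
  "first_module_structure b q D e A As \<Upsilon> \<Psi> \<pi> \<longleftrightarrow>
     uq_representation (of_real q) \<pi> \<and>
     A = cmat (param_h q e)
       + cmat (param_kappa q D e) ** matrix_inv \<Upsilon> ** \<Psi> ** \<pi> (uq_x (of_real q))
       + cmat (param_upsilon q D) ** \<Upsilon> ** matrix_inv \<Psi> ** \<pi> (uq_y (of_real q)) \<and>
     dual_adjacency_equation b q D e As \<Upsilon> \<Psi> \<pi>"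

definition second_module_structure ::
    "real \<Rightarrow> real \<Rightarrow> nat \<Rightarrow> real \<Rightarrow> complex^'x::finite^'x \<Rightarrow> complex^'x^'x \<Rightarrow> complex^'x^'x \<Rightarrow>
     complex^'x^'x \<Rightarrow> (free_uq set \<Rightarrow> complex^'x^'x) \<Rightarrow> bool" where
  "second_module_structure b q D e A As \<Upsilon> \<Psi> \<pi> \<longleftrightarrow>
     uq_representation (of_real q) \<pi> \<and>
     A = cmat (param_h q e)
       + cmat (param_kappa q D e) ** matrix_inv \<Upsilon> ** \<Psi> ** \<pi> (uq_y (of_real q))
       + cmat (param_upsilon q D) ** \<Upsilon> ** matrix_inv \<Psi> ** \<pi> (uq_x (of_real q)) \<and>
     dual_adjacency_equation b q D e As \<Upsilon> \<Psi> \<pi>"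

end

theory Submission
  imports Defs
begin

text \<open>Writing \<open>x = z\<^sup>-\<^sup>1 + F\<close> and \<open>y = z\<^sup>-\<^sup>1 + G\<close>, the equitable relations say that conjugation by \<open>z\<close>
  multiplies \<open>F\<close> by \<open>q\<^sup>-\<^sup>2\<close> and \<open>G\<close> by \<open>q\<^sup>2\<close>. Both module structures have the same \<open>z\<close>, which is
  determined by \<open>A\<^sup>*\<close>, \<open>\<Upsilon>\<close> and \<open>\<Psi>\<close> and hence commutes with \<open>\<Upsilon>\<close> and \<open>\<Psi>\<close>. Comparing the \<open>q\<^sup>-\<^sup>2\<close>- and
  \<open>q\<^sup>2\<close>-components of the two expressions for \<open>A\<close> expresses \<open>F\<close> and \<open>G\<close> of the second structure by those
  of the first. The elements \<open>\<Upsilon>\<close> and \<open>\<Psi>\<close> are invertible because the kernel of a central element is a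
  \<open>T\<close>-module, and an irreducible submodule of it would be acted on by a power of \<open>q\<close>.\<close>

section \<open>Scalar matrices, commuting products and inverses\<close>

lemma mat_nth: "mat c $ i $ j = (if i = j then c else 0)"
  by (simp add: mat_def)

lemma mat_mult_nth [simp]: "(mat c ** M) $ i $ j = c * M $ i $ j"
  for M :: "'a::semiring_1^'n^'m::finite"
  by (simp add: matrix_matrix_mult_def mat_def if_distrib if_distribR cong: if_cong)

lemma mat_mult_mat: "mat c ** mat d = (mat (c * d) :: 'a::semiring_1^'n::finite^'n)"
  by (simp add: vec_eq_iff mat_nth)

lemma mat_mult_commute: "M ** mat c = mat c ** M"
  for M :: "'a::comm_semiring_1^'n::finite^'n"
  by (simp add: vec_eq_iff)
    (simp add: matrix_matrix_mult_def mat_def if_distrib if_distribR mult.commute cong: if_cong)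

lemma mult_mat_mult: "M ** (mat c ** N) = mat c ** (M ** N)"
  for M :: "'a::comm_semiring_1^'n::finite^'n"
  by (simp add: matrix_mul_assoc mat_mult_commute[of M])

lemma matrix_mult_commute_mult:
  fixes M N P :: "'a::semiring_1^'n::finite^'n"
  assumes "M ** P = P ** M" "N ** P = P ** N"
  shows "M ** N ** P = P ** (M ** N)"
proof -
  have "M ** N ** P = M ** P ** N"
    by (simp add: assms(2) flip: matrix_mul_assoc)
  then show ?thesis
    by (simp add: assms(1) matrix_mul_assoc)
qed

lemma matrix_diff_ldistrib: "M ** (N - P) = M ** N - M ** P"
  for M :: "'a::ring_1^'n::finite^'m"
  by (simp add: vec_eq_iff matrix_matrix_mult_def right_diff_distrib sum_subtractf)

lemma matrix_diff_rdistrib: "(N - P) ** M = N ** M - P ** M"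
  for M :: "'a::ring_1^'k^'n::finite"
  by (simp add: vec_eq_iff matrix_matrix_mult_def left_diff_distrib sum_subtractf)

lemma matrix_inv_mult:
  fixes M :: "'a::field^'n::finite^'n"
  assumes "invertible M"
  shows "matrix_inv M ** M = mat 1" "M ** matrix_inv M = mat 1"
proof -
  have "M ** matrix_inv M = mat 1 \<and> matrix_inv M ** M = mat 1"
    using assms unfolding invertible_def matrix_inv_def by (rule someI_ex)
  then show "matrix_inv M ** M = mat 1" "M ** matrix_inv M = mat 1"
    by auto
qed

lemma matrix_inv_commute:
  fixes M N :: "'a::field^'n::finite^'n"
  assumes "invertible M" "M ** N = N ** M"
  shows "matrix_inv M ** N = N ** matrix_inv M"
proof -
  have "matrix_inv M ** N = matrix_inv M ** (N ** M) ** matrix_inv M"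
    by (simp add: matrix_inv_mult[OF assms(1)] flip: matrix_mul_assoc)
  also have "\<dots> = (matrix_inv M ** M) ** N ** matrix_inv M"
    by (simp add: assms(2)[symmetric] matrix_mul_assoc)
  finally show ?thesis
    by (simp add: matrix_inv_mult[OF assms(1)])
qed

section \<open>Invertibility of central elements acting by powers of q\<close>

text \<open>Strong induction on the dimension: a reducible nonzero submodule has a nonzero proper
  submodule, whose dimension is strictly smaller.\<close>

lemma submodule_contains_irreducible:
  assumes "submodule_of T W" "W \<noteq> {0}"
  obtains W' where "irreducible_submodule_of T W'" "W' \<subseteq> W"
proof -
  have "\<exists>W'. irreducible_submodule_of T W' \<and> W' \<subseteq> W"
    using assms
  proof (induction "vec.dim W" arbitrary: W rule: less_induct)
    case less
    show ?case
    proof (cases "irreducible_submodule_of T W")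
      case False
      then obtain W' where W': "submodule_of T W'" "W' \<subseteq> W" "W' \<noteq> {0}" "W' \<noteq> W"
        using less.prems unfolding irreducible_submodule_of_def by blast
      then have "vec.dim W' < vec.dim W"
        using less.prems vec.subspace_dim_equal[of W' W]
        unfolding submodule_of_def by (metis not_le)
      then show ?thesis
        using less.hyps W' by (meson subset_trans)
    qed blast
  qed
  then show ?thesis
    using that by blast
qed

lemma kernel_central_submodule:
  assumes "C \<in> center_of T"
  shows "submodule_of T {v. C *v v = 0}"
proof -
  have "C *v (M *v w) = 0" if "M \<in> T" "C *v w = 0" for M w
  proof -
    have "C ** M = M ** C"
      using assms that(1) by (simp add: center_of_def)
    then show ?thesis
      using that(2) by (simp add: matrix_vector_mul_assoc) (simp flip: matrix_vector_mul_assoc)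
  qed
  then show ?thesis
    by (auto simp: submodule_of_def vec.subspace_def matrix_vector_right_distrib vec.scale)
qed

text \<open>A single irreducible submodule inside the kernel already gives the contradiction, so no
  decomposition of the whole space into irreducibles enters. Positivity of \<open>q\<close> makes
  every integer power of it nonzero.\<close>

lemma acts_by_power_invertible:
  assumes "acts_by_power T q \<phi> C" "q > 0"
  shows "invertible C"
proof (rule ccontr)
  let ?K = "{v. C *v v = 0}"
  assume "\<not> invertible C"
  then obtain v where "C *v v = 0" "v \<noteq> 0"
    unfolding invertible_left_inverse matrix_left_invertible_ker by blast
  then have "?K \<noteq> {0}"
    by blast
  moreover have "submodule_of T ?K"
    using assms(1) by (intro kernel_central_submodule) (simp add: acts_by_power_def)
  ultimately obtain W where W: "irreducible_submodule_of T W" "W \<subseteq> ?K"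
    using submodule_contains_irreducible by blast
  then have "0 \<in> W" "W \<noteq> {0}"
    unfolding irreducible_submodule_of_def submodule_of_def by (simp_all add: vec.subspace_0)
  then obtain w where w: "w \<in> W" "w \<noteq> 0"
    by blast
  have "w \<in> vec.span (\<Union>{W'. irreducible_submodule_of T W' \<and> \<phi> W' = \<phi> W})"
    using W(1) w(1) by (intro vec.span_base) blast
  then have "C *v w = of_real (q powi \<phi> W) *s w"
    using assms(1) by (simp add: acts_by_power_def)
  moreover have "C *v w = 0"
    using W(2) w(1) by blast
  ultimately have "complex_of_real (q powi \<phi> W) *s w = 0"
    by (rule trans[OF sym])
  moreover have "q powi \<phi> W \<noteq> 0"
    using assms(2) by simp
  ultimately show False
    using w(2) unfolding vector_mul_eq_0 of_real_eq_0_iff by blast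
qed

section \<open>The relations of the quantum algebra in a matrix representation\<close>

lemma ring_free_uq_ring: "ring free_uq_ring"
proof (rule ringI)
  show "abelian_group free_uq_ring"
  proof (rule abelian_groupI)
    fix p assume "p \<in> carrier free_uq_ring"
    show "\<exists>p'\<in>carrier free_uq_ring. p' \<oplus>\<^bsub>free_uq_ring\<^esub> p = \<zero>\<^bsub>free_uq_ring\<^esub>"
      by (rule bexI[of _ "- p"]) (simp_all add: free_uq_ring_def)
  qed (simp_all add: free_uq_ring_def add_ac)
  show "Group.monoid free_uq_ring"
    by (rule Group.monoidI) (simp_all add: free_uq_ring_def mult.assoc)
qed (simp_all add: free_uq_ring_def distrib_left distrib_right)

lemma ideal_uq_ideal: "ideal (uq_ideal q) free_uq_ring"
  unfolding uq_ideal_def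
  by (rule ring.genideal_ideal[OF ring_free_uq_ring]) (simp add: free_uq_ring_def)

lemma uq_class_hom: "uq_class q \<in> ring_hom free_uq_ring (Uq q)"
  using ideal.rcos_ring_hom[OF ideal_uq_ideal, of q] by (simp add: Uq_def uq_class_def[abs_def])

text \<open>The generated ideal contains its generators and 0, so both cosets are the ideal
  itself.\<close>

lemma uq_class_relator:
  assumes "p \<in> uq_relators q"
  shows "uq_class q p = uq_class q 0"
proof -
  interpret ideal "uq_ideal q" free_uq_ring
    by (rule ideal_uq_ideal)
  have "p \<in> uq_ideal q"
    using assms ring.genideal_self[OF ring_free_uq_ring, of "uq_relators q"]
    by (auto simp: uq_ideal_def free_uq_ring_def)
  moreover have "0 \<in> uq_ideal q"
    using additive_subgroup.zero_closed[OF is_additive_subgroup]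
    by (simp add: free_uq_ring_def)
  ultimately show ?thesis
    unfolding uq_class_def using a_rcos_const by simp
qed

context
  fixes q :: complex and \<pi> :: "free_uq set \<Rightarrow> complex^'x::finite^'x"
  assumes \<pi>: "uq_representation q \<pi>"
begin

text \<open>Composing with the quotient map gives a ring homomorphism on the free algebra, so values
  on expressions in the generators can be computed termwise. The value on scalars comes from the
  linearity clause of \<open>uq_representation\<close>, applied to a multiple of 1.\<close>

lemma uq_representation_class_hom:
  "\<pi> (uq_class q (p + p')) = \<pi> (uq_class q p) + \<pi> (uq_class q p')"
  "\<pi> (uq_class q (p * p')) = \<pi> (uq_class q p) ** \<pi> (uq_class q p')"
  "\<pi> (uq_class q 1) = mat 1"
  "\<pi> (uq_class q (scalar c)) = mat c"
proof -
  have "\<pi> \<circ> uq_class q \<in> ring_hom free_uq_ring matrix_ring"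
    using \<pi> uq_class_hom by (auto simp: uq_representation_def intro: ring_hom_trans)
  then show "\<pi> (uq_class q (p + p')) = \<pi> (uq_class q p) + \<pi> (uq_class q p')"
    "\<pi> (uq_class q (p * p')) = \<pi> (uq_class q p) ** \<pi> (uq_class q p')"
    and one: "\<pi> (uq_class q 1) = mat 1"
    by (auto simp: ring_hom_def free_uq_ring_def matrix_ring_def)
  have "\<pi> (uq_class q (scalar c * 1)) = mat c ** \<pi> (uq_class q 1)"
    using \<pi> by (simp only: uq_representation_def)
  then show "\<pi> (uq_class q (scalar c)) = mat c"
    by (simp add: one)
qed

lemma uq_representation_class_diff:
  "\<pi> (uq_class q (p - p')) = \<pi> (uq_class q p) - \<pi> (uq_class q p')"
  using uq_representation_class_hom(1)[of "p - p'" p'] by (simp add: algebra_simps)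

lemmas uq_representation_class = uq_representation_class_hom uq_representation_class_diff

lemma uq_representation_relator:
  assumes "p - 1 \<in> uq_relators q"
  shows "\<pi> (uq_class q p) = mat 1"
proof -
  \<comment> \<open>Writing zero as \<open>0 - 0\<close> lets the rule for differences evaluate the
    right-hand side to the zero matrix.\<close>
  have "\<pi> (uq_class q (p - 1)) = \<pi> (uq_class q (0 - 0))"
    using uq_class_relator[OF assms] by simp
  then show ?thesis
    unfolding uq_representation_class by simp
qed

lemma uq_representation_z_inverse:
  "\<pi> (uq_z q) ** \<pi> (uq_class q (gen GZinv)) = mat 1"
  "\<pi> (uq_class q (gen GZinv)) ** \<pi> (uq_z q) = mat 1"
  using uq_representation_relator[of "gen GZ * gen GZinv"]
    uq_representation_relator[of "gen GZinv * gen GZ"]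
  by (simp_all add: uq_representation_class uq_relators_def uq_z_def)

text \<open>The equitable relation for u and v, cleared of denominators and solved for the product
  in the opposite order. The conditions on \<open>q\<close> make q - 1/q nonzero; the rest is scalar
  arithmetic in each entry.\<close>

lemma uq_representation_q_comm:
  assumes "q_comm q u v - 1 \<in> uq_relators q" "q \<noteq> 0" "q\<^sup>2 \<noteq> 1"
  shows "\<pi> (uq_class q v) ** \<pi> (uq_class q u) =
    mat (q\<^sup>2) ** (\<pi> (uq_class q u) ** \<pi> (uq_class q v)) - mat (q\<^sup>2 - 1)"
proof -
  have "\<pi> (uq_class q (q_comm q u v)) = mat 1"
    by (rule uq_representation_relator[OF assms(1)])
  then have *: "mat (inverse (q - inverse q)) **
      (mat q ** (\<pi> (uq_class q u) ** \<pi> (uq_class q v)) -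
       mat (inverse q) ** (\<pi> (uq_class q v) ** \<pi> (uq_class q u))) = (mat 1 :: complex^'x^'x)"
    by (simp add: q_comm_def uq_representation_class mult.assoc)
  have q: "q - inverse q \<noteq> 0"
    using assms(2,3) by (auto simp: field_simps power2_eq_square)
  show ?thesis
  proof (unfold vec_eq_iff, intro allI)
    fix i j
    let ?a = "(\<pi> (uq_class q u) ** \<pi> (uq_class q v)) $ i $ j"
    let ?b = "(\<pi> (uq_class q v) ** \<pi> (uq_class q u)) $ i $ j"
    let ?d = "(mat 1 :: complex^'x^'x) $ i $ j"
    have "inverse (q - inverse q) * (q * ?a - inverse q * ?b) = ?d"
      using arg_cong[OF *, of "\<lambda>M. M $ i $ j"] by simp
    then have "q * ?a - inverse q * ?b = (q - inverse q) * ?d"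
      using q by (simp add: divide_simps mult.commute)
    then have "?b = q\<^sup>2 * ?a - (q\<^sup>2 - 1) * ?d"
      using assms(2) by (simp add: field_simps power2_eq_square)
    then show "?b = (mat (q\<^sup>2) ** (\<pi> (uq_class q u) ** \<pi> (uq_class q v)) - mat (q\<^sup>2 - 1)) $ i $ j"
      by (simp add: mat_nth)
  qed
qed

text \<open>The relation between z and x reads xz = q^2 zx - (q^2 - 1). Subtracting 1/z from x
  lowers xz by 1 and q^2 zx by q^2, which absorbs the constant term exactly.\<close>

lemma uq_representation_x_weight:
  assumes "q \<noteq> 0" "q\<^sup>2 \<noteq> 1"
  shows "(\<pi> (uq_x q) - \<pi> (uq_class q (gen GZinv))) ** \<pi> (uq_z q) =
    mat (q\<^sup>2) ** (\<pi> (uq_z q) ** (\<pi> (uq_x q) - \<pi> (uq_class q (gen GZinv))))"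
proof -
  have "\<pi> (uq_x q) ** \<pi> (uq_z q) = mat (q\<^sup>2) ** (\<pi> (uq_z q) ** \<pi> (uq_x q)) - mat (q\<^sup>2 - 1)"
    unfolding uq_x_def uq_z_def
    by (rule uq_representation_q_comm) (simp_all add: assms uq_relators_def)
  then show ?thesis
    by (simp add: matrix_diff_ldistrib matrix_diff_rdistrib uq_representation_z_inverse)
      (simp add: vec_eq_iff mat_nth)
qed

text \<open>The same cancellation with y and z in place of z and x. Here z is the second argument of
  the relation, so the factor q^2 appears on the other side.\<close>

lemma uq_representation_y_weight:
  assumes "q \<noteq> 0" "q\<^sup>2 \<noteq> 1"
  shows "\<pi> (uq_z q) ** (\<pi> (uq_y q) - \<pi> (uq_class q (gen GZinv))) =
    mat (q\<^sup>2) ** ((\<pi> (uq_y q) - \<pi> (uq_class q (gen GZinv))) ** \<pi> (uq_z q))"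
proof -
  have "\<pi> (uq_z q) ** \<pi> (uq_y q) = mat (q\<^sup>2) ** (\<pi> (uq_y q) ** \<pi> (uq_z q)) - mat (q\<^sup>2 - 1)"
    unfolding uq_y_def uq_z_def
    by (rule uq_representation_q_comm) (simp_all add: assms uq_relators_def)
  then show ?thesis
    by (simp add: matrix_diff_ldistrib matrix_diff_rdistrib uq_representation_z_inverse)
      (simp add: vec_eq_iff mat_nth)
qed

lemma uq_representation_f:
  "\<pi> (uq_f q) = mat (inverse (q - inverse q)) ** (\<pi> (uq_x q) - \<pi> (uq_class q (gen GZinv)))"
  by (simp add: uq_f_def uq_x_def uq_representation_class)

text \<open>The identity 1 - zy = -z(y - 1/z) produces both the sign and the extra factor z.\<close>

lemma uq_representation_e:
  "\<pi> (uq_e q) = mat (- (inverse q * inverse (q - inverse q))) **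
     (\<pi> (uq_z q) ** (\<pi> (uq_y q) - \<pi> (uq_class q (gen GZinv))))"
  by (simp add: uq_e_def uq_y_def uq_representation_class matrix_diff_ldistrib
      uq_representation_z_inverse flip: uq_z_def)
    (simp add: vec_eq_iff mat_nth algebra_simps)

end

section \<open>Weight components for conjugation by z\<close>

text \<open>Coefficients commuting with \<open>Z\<close> preserve weights; this is what allows
  comparison of components whose coefficients are matrices built from \<Upsilon> and \<Psi>.\<close>

lemma weight_mult_left:
  fixes C M Z :: "complex^'x::finite^'x"
  assumes "C ** Z = Z ** C" "M ** Z = mat s ** (Z ** M)"
  shows "C ** M ** Z = mat s ** (Z ** (C ** M))"
proof -
  have "C ** M ** Z = mat s ** (C ** Z ** M)"
    by (simp add: assms(2) mult_mat_mult flip: matrix_mul_assoc)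
  then show ?thesis
    by (simp add: assms(1) matrix_mul_assoc)
qed

lemma weight_mult_right:
  fixes C M Z :: "complex^'x::finite^'x"
  assumes "C ** Z = Z ** C" "Z ** M = mat s ** (M ** Z)"
  shows "Z ** (C ** M) = mat s ** (C ** M ** Z)"
proof -
  have "Z ** (C ** M) = C ** (Z ** M)"
    by (simp add: assms(1) matrix_mul_assoc)
  then show ?thesis
    by (simp add: assms(2) mult_mat_mult flip: matrix_mul_assoc)
qed

text \<open>The difference \<open>M = P - P' = Q' - Q\<close> has both weights at once, so MZ = s ZM
  = s^2 MZ. Since s^2 differs from 1, MZ vanishes, and the right inverse of \<open>Z\<close> removes
  the factor \<open>Z\<close>.\<close>

lemma weight_components_unique:
  fixes Z P Q P' Q' :: "complex^'x::finite^'x"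
  assumes sum: "P + Q = P' + Q'" and Z: "Z ** Zi = mat 1" and s: "s\<^sup>2 \<noteq> 1"
    and P: "P ** Z = mat s ** (Z ** P)" "P' ** Z = mat s ** (Z ** P')"
    and Q: "Z ** Q = mat s ** (Q ** Z)" "Z ** Q' = mat s ** (Q' ** Z)"
  shows "P = P'" "Q = Q'"
proof -
  define M where "M = P - P'"
  have M: "M = Q' - Q"
    using sum by (simp add: M_def algebra_simps)
  have 1: "M ** Z = mat s ** (Z ** M)"
    by (simp add: M_def matrix_diff_ldistrib matrix_diff_rdistrib P)
  have 2: "Z ** M = mat s ** (M ** Z)"
    by (simp add: M matrix_diff_ldistrib matrix_diff_rdistrib Q)
  have 3: "mat s ** (mat s ** (M ** Z)) = mat (s\<^sup>2) ** (M ** Z)"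
    by (simp add: matrix_mul_assoc mat_mult_mat power2_eq_square)
  have "M ** Z = mat (s\<^sup>2) ** (M ** Z)"
    using 1 unfolding 2 3 .
  then have "M ** Z = 0"
    using s by (simp add: vec_eq_iff)
  then have "M ** (Z ** Zi) = 0"
    by (simp add: matrix_mul_assoc)
  then have "M = 0"
    by (simp add: Z)
  then show "P = P'" "Q = Q'"
    using M by (simp_all add: M_def)
qed

lemma cmat_mult_cmat: "cmat c ** cmat d = cmat (c * d)"
  by (simp add: cmat_def mat_mult_mat)

lemma cmat_commute: "cmat c ** M = M ** cmat c"
  for M :: "complex^'x::finite^'x"
  unfolding cmat_def by (rule mat_mult_commute[symmetric])

lemma cmat_cancel:
  assumes "c \<noteq> 0" "cmat c ** M = cmat c ** N"
  shows "M = N"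
  using assms by (simp add: cmat_def vec_eq_iff)

theorem theorem30p5:
  fixes smul :: "'k::{field,finite} \<Rightarrow> 'u::ab_group_add \<Rightarrow> 'u"
    and F :: "('k, 'u) polar_form"
    and D :: nat
    and e b q :: real
    and vert :: "'x::finite \<Rightarrow> 'u set"
    and x :: 'x
    and A As \<Upsilon> \<Psi> :: "complex^'x^'x"
    and E Es :: "nat \<Rightarrow> complex^'x^'x"
    and T :: "(complex^'x^'x) set"
    and \<pi>\<^sub>1 \<pi>\<^sub>2 :: "free_uq set \<Rightarrow> complex^'x^'x"
  assumes "vector_space smul"
    and "D \<ge> 3"
    and "dual_polar_type smul F D e"
    and "bij_betw vert UNIV (maximal_isotropic_subspaces smul F)"
    and "b = real CARD('k)"
    and "q = sqrt b"
    and "A = adjacency_matrix smul D vert"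
    and "E = eigenprojection A"
    and "Es = dual_idempotent smul D vert x"
    and "As = dual_adjacency_matrix A x"
    and "T = generated_algebra {A, As}"
    and "is_Upsilon T q D E Es \<Upsilon>"
    and "is_Psi T q D E Es \<Psi>"
    and "first_module_structure b q D e A As \<Upsilon> \<Psi> \<pi>\<^sub>1"
    and "second_module_structure b q D e A As \<Upsilon> \<Psi> \<pi>\<^sub>2"
  shows "\<pi>\<^sub>2 (uq_k (of_real q)) = \<pi>\<^sub>1 (uq_k (of_real q))
    \<and> \<pi>\<^sub>2 (uq_e (of_real q)) =
        cmat (- (q powr (- 2 * e))) ** (\<Upsilon> ** \<Upsilon>) ** (matrix_inv \<Psi> ** matrix_inv \<Psi>) ** \<pi>\<^sub>1 (uq_e (of_real q))
    \<and> \<pi>\<^sub>2 (uq_f (of_real q)) =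
        cmat (- (q powr (2 * e))) ** (matrix_inv \<Upsilon> ** matrix_inv \<Upsilon>) ** (\<Psi> ** \<Psi>) ** \<pi>\<^sub>1 (uq_f (of_real q))"
proof -
  let ?q = "complex_of_real q"
  let ?z = "uq_z ?q" and ?zi = "uq_class ?q (gen GZinv)"
  define \<Upsilon>i \<Psi>i where "\<Upsilon>i = matrix_inv \<Upsilon>" and "\<Psi>i = matrix_inv \<Psi>"
  define \<kappa> \<kappa>s \<upsilon> where "\<kappa> = param_kappa q D e" and "\<kappa>s = param_kappa_star b q D e"
    and "\<upsilon> = param_upsilon q D"

  \<comment> \<open>Nonvanishing of the constants\<close>
  have b: "b > 1"
    using assms(5) card_mono[of "UNIV :: 'k set" "{0, 1}"] by simp
  then have q: "q > 1"
    using assms(6) by simp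
  then have q2: "q\<^sup>2 > 1"
    by simp
  have q': "?q \<noteq> 0" "?q\<^sup>2 \<noteq> 1" "(?q\<^sup>2)\<^sup>2 \<noteq> 1"
  proof -
    show "?q \<noteq> 0"
      using q by simp
    have "q\<^sup>2 \<noteq> 1" "(q\<^sup>2)\<^sup>2 \<noteq> 1"
      using q2 one_less_power[of "q\<^sup>2" 2] by simp_all
    then show "?q\<^sup>2 \<noteq> 1" "(?q\<^sup>2)\<^sup>2 \<noteq> 1"
      by (metis of_real_eq_1_iff of_real_power)+
  qed
  have \<upsilon>: "\<upsilon> \<noteq> 0"
    using q by (simp add: \<upsilon>_def param_upsilon_def power2_eq_1_iff)
  \<comment> \<open>This ratio is the source of the scalar factors in the conclusion.\<close>
  have \<kappa>_\<upsilon>: "\<kappa> = - (q powr (2 * e)) * \<upsilon>"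
    using q by (simp add: \<kappa>_def \<upsilon>_def param_kappa_def param_upsilon_def powr_add powr_realpow)
  have \<kappa>: "\<kappa> \<noteq> 0"
    using \<upsilon> q by (simp add: \<kappa>_\<upsilon>)
  have \<kappa>s: "\<kappa>s \<noteq> 0"
  proof -
    have "b powr r + 1 > 0" "b powr r + b > 0" for r
      using b powr_ge_zero[of b r] by linarith+
    then show ?thesis
      using b q unfolding \<kappa>s_def param_kappa_star_def param_xi_def
      by (simp add: less_imp_neq[symmetric])
  qed

  \<comment> \<open>Invertibility and commutation of \<Upsilon> and \<Psi>\<close>
  have pow: "acts_by_power T q
      (\<lambda>W. int (endpoint D Es W) + int (endpoint D E W) + int (module_diam D Es W) - int D) \<Upsilon>"
    "acts_by_power T q (\<lambda>W. int (endpoint D Es W) - int (endpoint D E W)) \<Psi>"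
    using assms(12,13) by (simp_all add: is_Upsilon_def is_Psi_def)
  have inv: "invertible \<Upsilon>" "invertible \<Psi>"
    using pow[THEN acts_by_power_invertible] q by simp_all
  have centre: "\<Upsilon> \<in> center_of T" "\<Psi> \<in> center_of T"
    using pow by (simp_all add: acts_by_power_def)
  note \<Upsilon>i = matrix_inv_mult[OF inv(1), folded \<Upsilon>i_def]
  note \<Psi>i = matrix_inv_mult[OF inv(2), folded \<Psi>i_def]
  have As: "As \<in> T"
    using assms(11) by (auto intro: generated_algebra.intros)
  have \<Upsilon>\<Psi>: "\<Upsilon> ** \<Psi> = \<Psi> ** \<Upsilon>" and \<Upsilon>As: "\<Upsilon> ** As = As ** \<Upsilon>" and \<Psi>As: "\<Psi> ** As = As ** \<Psi>"
    using centre As unfolding center_of_def by blast+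
  have \<Upsilon>i\<Psi>: "\<Upsilon>i ** \<Psi> = \<Psi> ** \<Upsilon>i"
    unfolding \<Upsilon>i_def using inv(1) \<Upsilon>\<Psi> by (rule matrix_inv_commute)
  have \<Psi>i\<Upsilon>: "\<Psi>i ** \<Upsilon> = \<Upsilon> ** \<Psi>i"
    unfolding \<Psi>i_def using inv(2) \<Upsilon>\<Psi>[symmetric] by (rule matrix_inv_commute)

  have rep: "uq_representation ?q \<pi>\<^sub>1" "uq_representation ?q \<pi>\<^sub>2"
    using assms(14,15) by (simp_all add: first_module_structure_def second_module_structure_def)

  \<comment> \<open>The common action of z\<close>
  \<comment> \<open>The right-hand side does not involve \<pi>; as \<kappa>s is nonzero, it
    determines the matrix of z.\<close>
  have z_eq: "cmat \<kappa>s ** \<pi> ?z = \<Psi> ** \<Upsilon> ** (As - cmat (param_h_star b D e))"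
    if "dual_adjacency_equation b q D e As \<Upsilon> \<Psi> \<pi>" for \<pi>
  proof -
    have "As - cmat (param_h_star b D e) = cmat \<kappa>s ** (\<Upsilon>i ** (\<Psi>i ** \<pi> ?z))"
      using that unfolding dual_adjacency_equation_def
      by (simp add: \<kappa>s_def \<Upsilon>i_def \<Psi>i_def matrix_mul_assoc)
    then have "\<Psi> ** \<Upsilon> ** (As - cmat (param_h_star b D e)) =
        cmat \<kappa>s ** (\<Psi> ** (\<Upsilon> ** \<Upsilon>i) ** (\<Psi>i ** \<pi> ?z))"
      by (simp add: cmat_def mult_mat_mult flip: matrix_mul_assoc)
    also have "\<Psi> ** (\<Upsilon> ** \<Upsilon>i) ** (\<Psi>i ** \<pi> ?z) = \<pi> ?z"
      by (simp add: \<Upsilon>i \<Psi>i matrix_mul_assoc)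
    finally show ?thesis ..
  qed
  have z1: "cmat \<kappa>s ** \<pi>\<^sub>1 ?z = \<Psi> ** \<Upsilon> ** (As - cmat (param_h_star b D e))"
    using assms(14) by (intro z_eq) (simp add: first_module_structure_def)
  have z2: "cmat \<kappa>s ** \<pi>\<^sub>2 ?z = \<Psi> ** \<Upsilon> ** (As - cmat (param_h_star b D e))"
    using assms(15) by (intro z_eq) (simp add: second_module_structure_def)
  define Z where "Z = \<pi>\<^sub>1 ?z"
  have Z2: "\<pi>\<^sub>2 ?z = Z"
    using cmat_cancel[OF \<kappa>s] z1 z2 by (metis Z_def)
  define Zi where "Zi = \<pi>\<^sub>1 ?zi"
  have ZZi: "Z ** Zi = mat 1" "Zi ** Z = mat 1"
    using uq_representation_z_inverse[OF rep(1)] by (simp_all add: Z_def Zi_def)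
  \<comment> \<open>A matrix has at most one two-sided inverse, and both candidates invert
    \<open>Z\<close>.\<close>
  have Zi2: "\<pi>\<^sub>2 ?zi = Zi"
    using uq_representation_z_inverse[OF rep(2)] ZZi
    by (metis Z2 matrix_mul_assoc matrix_mul_lid matrix_mul_rid)

  \<comment> \<open>Up to the nonzero scalar \<kappa>s, \<open>Z\<close> is a product of \<Psi>,
    \<Upsilon> and a scalar shift of \<open>As\<close>, so commuting with these three is
    enough.\<close>
  have comm_Z: "C ** Z = Z ** C"
    if C: "C ** \<Upsilon> = \<Upsilon> ** C" "C ** \<Psi> = \<Psi> ** C" "C ** As = As ** C" for C
  proof -
    have "cmat \<kappa>s ** (C ** Z) = C ** (cmat \<kappa>s ** Z)"
      by (simp add: cmat_def mult_mat_mult)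
    also have "\<dots> = C ** \<Psi> ** \<Upsilon> ** (As - cmat (param_h_star b D e))"
      by (simp add: Z_def z1 matrix_mul_assoc)
    also have "C ** \<Psi> ** \<Upsilon> = \<Psi> ** \<Upsilon> ** C"
      using matrix_mult_commute_mult[OF C(2)[symmetric] C(1)[symmetric]]
      by (simp only: matrix_mul_assoc)
    also have "\<Psi> ** \<Upsilon> ** C ** (As - cmat (param_h_star b D e)) =
        \<Psi> ** \<Upsilon> ** ((As - cmat (param_h_star b D e)) ** C)"
    proof -
      have "C ** (As - cmat (param_h_star b D e)) = (As - cmat (param_h_star b D e)) ** C"
        by (simp add: C(3) matrix_diff_ldistrib matrix_diff_rdistrib cmat_commute[of _ C])
      then show ?thesis
        by (simp flip: matrix_mul_assoc)
    qed
    also have "\<dots> = cmat \<kappa>s ** (Z ** C)"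
      by (simp add: Z_def matrix_mul_assoc z1)
    finally show ?thesis
      by (rule cmat_cancel[OF \<kappa>s])
  qed
  have \<Upsilon>Z: "\<Upsilon> ** Z = Z ** \<Upsilon>" and \<Psi>Z: "\<Psi> ** Z = Z ** \<Psi>"
    using comm_Z \<Upsilon>\<Psi> \<Upsilon>As \<Psi>As by metis+
  have \<Upsilon>iZ: "\<Upsilon>i ** Z = Z ** \<Upsilon>i"
    unfolding \<Upsilon>i_def using inv(1) \<Upsilon>Z by (rule matrix_inv_commute)
  have \<Psi>iZ: "\<Psi>i ** Z = Z ** \<Psi>i"
    unfolding \<Psi>i_def using inv(2) \<Psi>Z by (rule matrix_inv_commute)

  \<comment> \<open>Comparison of the two expressions for \<open>A\<close>\<close>
  \<comment> \<open>These are the coefficients of x and y in the first structure, and of y and x in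
    the second.\<close>
  define \<alpha> \<beta> where "\<alpha> = cmat \<kappa> ** (\<Upsilon>i ** \<Psi>)" and "\<beta> = cmat \<upsilon> ** (\<Upsilon> ** \<Psi>i)"
  have \<alpha>Z: "\<alpha> ** Z = Z ** \<alpha>"
    unfolding \<alpha>_def by (intro matrix_mult_commute_mult cmat_commute \<Upsilon>iZ \<Psi>Z)
  have \<beta>Z: "\<beta> ** Z = Z ** \<beta>"
    unfolding \<beta>_def by (intro matrix_mult_commute_mult cmat_commute \<Upsilon>Z \<Psi>iZ)

  define F\<^sub>1 F\<^sub>2 G\<^sub>1 G\<^sub>2 where "F\<^sub>1 = \<pi>\<^sub>1 (uq_x ?q) - Zi" and "F\<^sub>2 = \<pi>\<^sub>2 (uq_x ?q) - Zi"
    and "G\<^sub>1 = \<pi>\<^sub>1 (uq_y ?q) - Zi" and "G\<^sub>2 = \<pi>\<^sub>2 (uq_y ?q) - Zi"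
  have F: "F\<^sub>1 ** Z = mat (?q\<^sup>2) ** (Z ** F\<^sub>1)" "F\<^sub>2 ** Z = mat (?q\<^sup>2) ** (Z ** F\<^sub>2)"
    using rep[THEN uq_representation_x_weight, OF q'(1,2)]
    unfolding F\<^sub>1_def F\<^sub>2_def Z2 Zi2 Z_def Zi_def by simp_all
  have G: "Z ** G\<^sub>1 = mat (?q\<^sup>2) ** (G\<^sub>1 ** Z)" "Z ** G\<^sub>2 = mat (?q\<^sup>2) ** (G\<^sub>2 ** Z)"
    using rep[THEN uq_representation_y_weight, OF q'(1,2)]
    unfolding G\<^sub>1_def G\<^sub>2_def Z2 Zi2 Z_def Zi_def by simp_all
  have "A = cmat (param_h q e) + \<alpha> ** \<pi>\<^sub>1 (uq_x ?q) + \<beta> ** \<pi>\<^sub>1 (uq_y ?q)"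
    using assms(14) by (simp add: first_module_structure_def \<alpha>_def \<beta>_def \<kappa>_def \<upsilon>_def \<Upsilon>i_def \<Psi>i_def
        matrix_mul_assoc)
  moreover have "A = cmat (param_h q e) + \<alpha> ** \<pi>\<^sub>2 (uq_y ?q) + \<beta> ** \<pi>\<^sub>2 (uq_x ?q)"
    using assms(15) by (simp add: second_module_structure_def \<alpha>_def \<beta>_def \<kappa>_def \<upsilon>_def \<Upsilon>i_def \<Psi>i_def
        matrix_mul_assoc)
  ultimately have "\<alpha> ** \<pi>\<^sub>1 (uq_x ?q) + \<beta> ** \<pi>\<^sub>1 (uq_y ?q) = \<alpha> ** \<pi>\<^sub>2 (uq_y ?q) + \<beta> ** \<pi>\<^sub>2 (uq_x ?q)"
    by (simp add: add.assoc)
  \<comment> \<open>The contribution of 1/z is (\<alpha> + \<beta>) \<open>Zi\<close> on both sides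
    and cancels. The terms on the right are ordered by weight, the x-part first.\<close>
  then have sum: "\<alpha> ** F\<^sub>1 + \<beta> ** G\<^sub>1 = \<beta> ** F\<^sub>2 + \<alpha> ** G\<^sub>2"
    by (simp add: F\<^sub>1_def F\<^sub>2_def G\<^sub>1_def G\<^sub>2_def matrix_diff_ldistrib algebra_simps)
  have FF: "\<alpha> ** F\<^sub>1 = \<beta> ** F\<^sub>2" and GG: "\<beta> ** G\<^sub>1 = \<alpha> ** G\<^sub>2"
    using weight_components_unique[OF sum ZZi(1) q'(3)]
      weight_mult_left[OF \<alpha>Z F(1)] weight_mult_left[OF \<beta>Z F(2)]
      weight_mult_right[OF \<beta>Z G(1)] weight_mult_right[OF \<alpha>Z G(2)]
    by blast+

  \<comment> \<open>In \<open>FF\<close> the factor \<open>\<Upsilon> ** \<Psi>i\<close> of \<beta>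
    is removed by multiplying with its inverse \<open>\<Psi> ** \<Upsilon>i\<close>. Since this
    inverse has the same form as the factor in \<alpha>, the squares of \<open>\<Upsilon>i\<close>
    and \<Psi> arise; the scalar is \<kappa>/\<upsilon>.\<close>
  have F2: "F\<^sub>2 = cmat (- (q powr (2 * e))) ** (\<Upsilon>i ** \<Upsilon>i) ** (\<Psi> ** \<Psi>) ** F\<^sub>1"
  proof (rule cmat_cancel[OF \<upsilon>])
    have "cmat \<upsilon> ** F\<^sub>2 = \<Psi> ** \<Upsilon>i ** (\<beta> ** F\<^sub>2)"
    proof -
      have "\<Psi> ** \<Upsilon>i ** (\<beta> ** F\<^sub>2) = cmat \<upsilon> ** (\<Psi> ** (\<Upsilon>i ** \<Upsilon>) ** \<Psi>i ** F\<^sub>2)"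
        by (simp add: \<beta>_def cmat_def mult_mat_mult flip: matrix_mul_assoc)
      then show ?thesis
        by (simp add: \<Upsilon>i \<Psi>i)
    qed
    also have "\<dots> = cmat \<kappa> ** (\<Psi> ** \<Upsilon>i ** \<Upsilon>i ** \<Psi> ** F\<^sub>1)"
      by (simp add: FF[symmetric] \<alpha>_def cmat_def mult_mat_mult flip: matrix_mul_assoc)
    also have "\<Psi> ** \<Upsilon>i ** \<Upsilon>i ** \<Psi> = (\<Upsilon>i ** \<Upsilon>i) ** (\<Psi> ** \<Psi>)"
      using matrix_mult_commute_mult[OF \<Upsilon>i\<Psi> \<Upsilon>i\<Psi>] by (simp add: matrix_mul_assoc)
    finally show "cmat \<upsilon> ** F\<^sub>2 =
        cmat \<upsilon> ** (cmat (- (q powr (2 * e))) ** (\<Upsilon>i ** \<Upsilon>i) ** (\<Psi> ** \<Psi>) ** F\<^sub>1)"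
      by (simp add: \<kappa>_\<upsilon> matrix_mul_assoc cmat_mult_cmat mult.commute)
  qed
  \<comment> \<open>The mirror computation from \<open>GG\<close>: now \<alpha> is inverted, so
    \<Upsilon> and \<Psi> occur with opposite exponents and the scalar is
    \<upsilon>/\<kappa>.\<close>
  have G2: "G\<^sub>2 = cmat (- (q powr (- 2 * e))) ** (\<Upsilon> ** \<Upsilon>) ** (\<Psi>i ** \<Psi>i) ** G\<^sub>1"
  proof (rule cmat_cancel[OF \<kappa>])
    have "cmat \<kappa> ** G\<^sub>2 = \<Psi>i ** \<Upsilon> ** (\<alpha> ** G\<^sub>2)"
    proof -
      have "\<Psi>i ** \<Upsilon> ** (\<alpha> ** G\<^sub>2) = cmat \<kappa> ** (\<Psi>i ** (\<Upsilon> ** \<Upsilon>i) ** \<Psi> ** G\<^sub>2)"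
        by (simp add: \<alpha>_def cmat_def mult_mat_mult flip: matrix_mul_assoc)
      then show ?thesis
        by (simp add: \<Upsilon>i \<Psi>i)
    qed
    also have "\<dots> = cmat \<upsilon> ** (\<Psi>i ** \<Upsilon> ** \<Upsilon> ** \<Psi>i ** G\<^sub>1)"
      by (simp add: GG[symmetric] \<beta>_def cmat_def mult_mat_mult flip: matrix_mul_assoc)
    also have "\<Psi>i ** \<Upsilon> ** \<Upsilon> ** \<Psi>i = (\<Upsilon> ** \<Upsilon>) ** (\<Psi>i ** \<Psi>i)"
      using matrix_mult_commute_mult[OF \<Psi>i\<Upsilon>[symmetric] \<Psi>i\<Upsilon>[symmetric]]
      by (simp add: matrix_mul_assoc)
    moreover have "\<upsilon> = \<kappa> * - (q powr (- 2 * e))"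
      using q by (simp add: \<kappa>_\<upsilon> powr_minus)
    ultimately show "cmat \<kappa> ** G\<^sub>2 =
        cmat \<kappa> ** (cmat (- (q powr (- 2 * e))) ** (\<Upsilon> ** \<Upsilon>) ** (\<Psi>i ** \<Psi>i) ** G\<^sub>1)"
      by (simp add: matrix_mul_assoc cmat_mult_cmat)
  qed

  \<comment> \<open>Passage to e and f\<close>
  have pi_f: "\<pi>\<^sub>1 (uq_f ?q) = mat (inverse (?q - inverse ?q)) ** F\<^sub>1"
    "\<pi>\<^sub>2 (uq_f ?q) = mat (inverse (?q - inverse ?q)) ** F\<^sub>2"
    using rep[THEN uq_representation_f] by (simp_all add: F\<^sub>1_def F\<^sub>2_def Zi2 Zi_def)
  have pi_e: "\<pi>\<^sub>1 (uq_e ?q) = mat (- (inverse ?q * inverse (?q - inverse ?q))) ** (Z ** G\<^sub>1)"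
    "\<pi>\<^sub>2 (uq_e ?q) = mat (- (inverse ?q * inverse (?q - inverse ?q))) ** (Z ** G\<^sub>2)"
    using rep[THEN uq_representation_e] by (simp_all add: G\<^sub>1_def G\<^sub>2_def Z2 Zi2 Z_def Zi_def)
  \<comment> \<open>The image of e carries a factor \<open>Z\<close> on the left, which has to be
    moved past the coefficient of \<open>G\<^sub>1\<close>; the image of f is a scalar multiple of
    its component.\<close>
  have "Z ** (K ** G\<^sub>1) = K ** (Z ** G\<^sub>1)" if "K ** Z = Z ** K" for K
    by (simp add: that matrix_mul_assoc)
  moreover have "cmat c ** (\<Upsilon> ** \<Upsilon>) ** (\<Psi>i ** \<Psi>i) ** Z =
      Z ** (cmat c ** (\<Upsilon> ** \<Upsilon>) ** (\<Psi>i ** \<Psi>i))" for c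
    by (intro matrix_mult_commute_mult cmat_commute \<Upsilon>Z \<Psi>iZ)
  ultimately have "Z ** (cmat c ** (\<Upsilon> ** \<Upsilon>) ** (\<Psi>i ** \<Psi>i) ** G\<^sub>1) =
      cmat c ** (\<Upsilon> ** \<Upsilon>) ** (\<Psi>i ** \<Psi>i) ** (Z ** G\<^sub>1)" for c
    by blast
  then have "\<pi>\<^sub>2 (uq_e ?q) =
      cmat (- (q powr (- 2 * e))) ** (\<Upsilon> ** \<Upsilon>) ** (\<Psi>i ** \<Psi>i) ** \<pi>\<^sub>1 (uq_e ?q)"
    unfolding pi_e G2 mult_mat_mult by simp
  moreover have "\<pi>\<^sub>2 (uq_f ?q) =
      cmat (- (q powr (2 * e))) ** (\<Upsilon>i ** \<Upsilon>i) ** (\<Psi> ** \<Psi>) ** \<pi>\<^sub>1 (uq_f ?q)"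
    unfolding pi_f F2 mult_mat_mult ..
  moreover have "\<pi>\<^sub>2 (uq_k ?q) = \<pi>\<^sub>1 (uq_k ?q)"
    using Z2 by (simp add: uq_k_def Z_def)
  ultimately show ?thesis
    unfolding \<Upsilon>i_def \<Psi>i_def by blast
qed

end
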